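(* Let $n=1$ and, with the coordinate polynomials $x_0,x_1,x_2,x_3\in\operatorname{Sym}\mathscr P\langle q,\bar q\rangle$ given in the context, set $$h=1-|q|^2,\quad g_1=\tfrac1{10}+x_0,\quad g_2=\tfrac1{10}-x_0,\quad g_3=\tfrac12+x_1,\quad g_4=\tfrac12+x_2,\quad g_5=\tfrac12+x_3,$$ $$f=x_1+x_2+x_3+\tfrac25,\qquad K=\{a\in\mathbb H:\ h(a,\bar a)=0,\ g_i(a,\bar a)\ge0,\ i=1,\dots,5\}.$$ Then $\min_{a\in K}f(a,\bar a)=\tfrac1{10}>0$, whereas $$f\notin\mathcal Q^{\mathbb H}(\mathbf g,h)+\left(\mathcal I_1^{\mathbb H}\cap\operatorname{Sym}\mathscr P\langle q,\bar q\rangle\right),$$ where $\mathbf g=\{g_1,\dots,g_5\}$. Moreover, each of $f,h,g_1,\dots,g_5$ is, modulo $\mathcal I_1^{\mathbb H}$, of the form $\begin{bmatrix} 1 \\ q \end{bmatrix}^*Q\begin{bmatrix} 1 \\ q \end{bmatrix}$ with $Q\in\mathbb H^{2\times2}$ Hermitian.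
   Context: $\mathbb H$ is the skew field of quaternions with units $\mathbf i,\mathbf j,\mathbf k$. $\mathcal W$ is the set of words (including the empty word $1$) in two letters $q,\bar q$, where words with the same normal form are identified (consecutive factors $q\bar q$ and $\bar qq$ are both written $|q|^2$ and moved to the front). $w^*$ is obtained by reversing $w$ and exchanging $q\leftrightarrow\bar q$. $\mathbb R\langle q,\bar q\rangle$ is the real $*$-algebra of finite sums $\sum_wp_ww$, $p_w\in\mathbb R$. $\mathbb H\langle q,\bar q\rangle$ is the real free product of $\mathbb H$ (involution: conjugation) and $\mathbb R\langle q,\bar q\rangle$; quaternionic constants do not commute with letters. Inside it, $\mathcal L$ is the space of left-coefficient polynomials $\sum_wp_ww$, $p_w\in\mathbb H$, and $\mathscr P\langle q,\bar q\rangle$ is the space of finite sums $\sum_{a,b\in\mathcal W}a\,p_{a,b}\,b$, $p_{a,b}\in\mathbb H$. $\operatorname{Sym}$ denotes the set of elements with $p=p^*$. Evaluation at $a\in\mathbb H$ means $q\mapsto a$, $\bar q\mapsto\bar a$. The coordinate polynomials are $$x_0=\tfrac{q+\bar q}2,\quad x_1=\tfrac{\mathbf i\bar q-q\mathbf i}2,\quad x_2=\tfrac{\mathbf j\bar q-q\mathbf j}2,\quad x_3=\tfrac{\mathbf k\bar q-q\mathbf k}2,$$ whose evaluations at $a=a_0+a_1\mathbf i+a_2\mathbf j+a_3\mathbf k$ are $a_0,a_1,a_2,a_3$. $\mathcal I_1^{\mathbb H}$ is the two-sided $*$-ideal of all elements of $\mathbb H\langle q,\bar q\rangle$ vanishing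 under evaluation at every $a\in\mathbb H$. $\Sigma^{\mathbb H}$ is the set of finite sums $\sum_sp_s^*p_s$, $p_s\in\mathcal L$. $\mathcal Q^{\mathbb H}(\mathbf g,h)$ is the set of all elements $$\sigma_0+\tfrac12\sum_{i=1}^5(\sigma_ig_i+g_i\sigma_i)+\sum_\alpha\left(\tau_\alpha h\nu_\alpha^*+\nu_\alpha h^*\tau_\alpha^*\right)$$ of $\mathbb H\langle q,\bar q\rangle$ (finite sums) with $\sigma_i\in\Sigma^{\mathbb H}$, $\tau_\alpha,\nu_\alpha\in\mathcal L$. *)

theory Defs
  imports "HOL-Analysis.Analysis" "HOL-Library.Poly_Mapping"
begin

section \<open>Involutions\<close>

class star =
  fixes star :: "'a \<Rightarrow> 'a"  (\<open>(_\<^sup>\<star>)\<close> [1000] 999)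

definition Sym :: "'a::star set" where
  "Sym = {p. p\<^sup>\<star> = p}"


section \<open>Quaternions\<close>

datatype quat = Quat (qRe: real) (qI: real) (qJ: real) (qK: real)

lemma quat_eq_iff: "x = y \<longleftrightarrow> qRe x = qRe y \<and> qI x = qI y \<and> qJ x = qJ y \<and> qK x = qK y"
  by (cases x; cases y) auto

instantiation quat :: "{ring_1, real_algebra_1}"
begin
definition "0 = Quat 0 0 0 0"
definition "1 = Quat 1 0 0 0"
definition "x + y = Quat (qRe x + qRe y) (qI x + qI y) (qJ x + qJ y) (qK x + qK y)"
definition "- x = Quat (- qRe x) (- qI x) (- qJ x) (- qK x)"
definition "x - y = Quat (qRe x - qRe y) (qI x - qI y) (qJ x - qJ y) (qK x - qK y)"
definition "x * y = Quat
  (qRe x * qRe y - qI x * qI y - qJ x * qJ y - qK x * qK y)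
  (qRe x * qI y + qI x * qRe y + qJ x * qK y - qK x * qJ y)
  (qRe x * qJ y - qI x * qK y + qJ x * qRe y + qK x * qI y)
  (qRe x * qK y + qI x * qJ y - qJ x * qI y + qK x * qRe y)"
definition "r *\<^sub>R x = Quat (r * qRe x) (r * qI x) (r * qJ x) (r * qK x)"
instance
  by standard (auto simp: zero_quat_def one_quat_def plus_quat_def uminus_quat_def
      minus_quat_def times_quat_def scaleR_quat_def quat_eq_iff algebra_simps)
end

lemmas quat_defs = zero_quat_def one_quat_def plus_quat_def uminus_quat_def
  minus_quat_def times_quat_def scaleR_quat_def

lemma of_real_quat: "of_real r = Quat r 0 0 0"
  by (simp add: of_real_def quat_defs)

instantiation quat :: star
begin
definition "x\<^sup>\<star> = Quat (qRe x) (- qI x) (- qJ x) (- qK x)"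
instance ..
end

instantiation quat :: division_ring
begin
definition "inverse x = inverse ((qRe x)\<^sup>2 + (qI x)\<^sup>2 + (qJ x)\<^sup>2 + (qK x)\<^sup>2) *\<^sub>R x\<^sup>\<star>"
definition "x div y = x * inverse (y :: quat)"
instance
proof
  fix x :: quat
  let ?n = "(qRe x)\<^sup>2 + (qI x)\<^sup>2 + (qJ x)\<^sup>2 + (qK x)\<^sup>2"
  assume "x \<noteq> 0"
  then have "qRe x \<noteq> 0 \<or> qI x \<noteq> 0 \<or> qJ x \<noteq> 0 \<or> qK x \<noteq> 0"
    by (auto simp: quat_defs quat_eq_iff)
  then have n: "?n \<noteq> 0"
    by (smt (verit) zero_le_power2 power2_less_eq_zero_iff)
  have "x\<^sup>\<star> * x = ?n *\<^sub>R 1" "x * x\<^sup>\<star> = ?n *\<^sub>R 1"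
    by (simp_all add: quat_defs star_quat_def quat_eq_iff power2_eq_square)
  then show "inverse x * x = 1" "x * inverse x = 1"
    using n by (simp_all add: inverse_quat_def)
qed (auto simp: divide_quat_def inverse_quat_def quat_defs)
end

text \<open>As in the complex case: comparable quaternions differ by a real number, so
  \<open>0 \<le> x\<close> means that \<open>x\<close> is a nonnegative real.\<close>

instantiation quat :: order
begin
definition "x \<le> y \<longleftrightarrow> qRe x \<le> qRe y \<and> qI x = qI y \<and> qJ x = qJ y \<and> qK x = qK y"
definition "x < y \<longleftrightarrow> qRe x < qRe y \<and> qI x = qI y \<and> qJ x = qJ y \<and> qK x = qK y"
instance
  by standard (auto simp: less_eq_quat_def less_quat_def quat_eq_iff)
end

lemma quat_nonneg_iff: "0 \<le> (x :: quat) \<longleftrightarrow> (\<exists>r\<ge>0. x = of_real r)"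
  by (auto simp: less_eq_quat_def of_real_quat quat_defs quat_eq_iff)

definition quat_i :: quat where "quat_i = Quat 0 1 0 0"
definition quat_j :: quat where "quat_j = Quat 0 0 1 0"
definition quat_k :: quat where "quat_k = Quat 0 0 0 1"

lemma quat_star_simps:
  fixes x y :: quat
  shows "(x\<^sup>\<star>)\<^sup>\<star> = x" "(x + y)\<^sup>\<star> = x\<^sup>\<star> + y\<^sup>\<star>" "(x * y)\<^sup>\<star> = y\<^sup>\<star> * x\<^sup>\<star>"
    "(of_real r :: quat)\<^sup>\<star> = of_real r" "(r *\<^sub>R x)\<^sup>\<star> = r *\<^sub>R x\<^sup>\<star>"
    "(0 :: quat)\<^sup>\<star> = 0" "(1 :: quat)\<^sup>\<star> = 1"
  by (auto simp: star_quat_def quat_defs quat_eq_iff of_real_quat algebra_simps)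

definition quat_sqnorm :: "quat \<Rightarrow> real" where
  "quat_sqnorm x = (qRe x)\<^sup>2 + (qI x)\<^sup>2 + (qJ x)\<^sup>2 + (qK x)\<^sup>2"

lemma quat_mult_star:
  "x * x\<^sup>\<star> = of_real (quat_sqnorm x)" "x\<^sup>\<star> * x = of_real (quat_sqnorm x)"
  by (auto simp: star_quat_def quat_defs quat_eq_iff of_real_quat quat_sqnorm_def
      power2_eq_square algebra_simps)

lemma of_real_quat_commute: "of_real r * (x :: quat) = x * of_real r"
  by (simp add: of_real_quat quat_defs)


section \<open>Words\<close>

datatype letter = Q | Qbar

primrec letter_star :: "letter \<Rightarrow> letter" where
  "letter_star Q = Qbar"
| "letter_star Qbar = Q"

text \<open>\<open>normal_form w = (k, v)\<close> means that \<open>w\<close> has the normal form \<open>|q|\<^sup>2\<^sup>k v\<close>, where \<open>v\<close>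
  contains neither \<open>q qbar\<close> nor \<open>qbar q\<close> as consecutive letters.\<close>

primrec normal_form :: "letter list \<Rightarrow> nat \<times> letter list" where
  "normal_form [] = (0, [])"
| "normal_form (x # w) =
     (case normal_form w of (k, v) \<Rightarrow>
       (case v of
          [] \<Rightarrow> (k, [x])
        | y # v' \<Rightarrow> if x = y then (k, x # v) else (Suc k, v')))"

lemma normal_form_eq:
  "normal_form w =
     (min (count_list w Q) (count_list w Qbar),
      replicate (count_list w Q - count_list w Qbar) Q @
      replicate (count_list w Qbar - count_list w Q) Qbar)"
proof (induction w)
  case (Cons x w)
  let ?m = "count_list w Q" and ?n = "count_list w Qbar"
  consider "?m = ?n" | d where "?m = Suc d + ?n" | d where "?n = Suc d + ?m"
    by (metis add.commute add_Suc_right less_iff_Suc_add nat_neq_iff)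
  then show ?case
    by cases (cases x; simp add: Cons.IH)+
qed simp

lemma normal_form_eq_iff:
  "normal_form u = normal_form v \<longleftrightarrow>
     count_list u Q = count_list v Q \<and> count_list u Qbar = count_list v Qbar"
proof
  assume *: "normal_form u = normal_form v"
  have len: "fst (normal_form w) + length (filter (\<lambda>x. x = y) (snd (normal_form w))) = count_list w y"
    for w y
    by (cases y) (auto simp: normal_form_eq filter_replicate)
  show "count_list u Q = count_list v Q \<and> count_list u Qbar = count_list v Qbar"
    using len[of u] len[of v] * by metis
qed (simp add: normal_form_eq)

quotient_type word = "letter list" / "\<lambda>u v. normal_form u = normal_form v"
  by (auto intro!: equivpI reflpI sympI transpI)

lift_definition word_Q :: word is "[Q]" .
lift_definition word_Qbar :: word is "[Qbar]" .

text \<open>The monoid of words is written additively, because the product of the type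
  \<open>_ \<Rightarrow>\<^sub>0 _\<close> is convolution over an additive monoid: \<open>0\<close> is the empty word and \<open>+\<close> is
  concatenation.\<close>

instantiation word :: monoid_add
begin
lift_definition zero_word :: word is "[]" .
lift_definition plus_word :: "word \<Rightarrow> word \<Rightarrow> word" is "(@)"
  by (simp add: normal_form_eq_iff)
instance
  by standard (transfer; simp)+
end

lemma count_list_map_letter_star:
  "count_list (map letter_star w) Q = count_list w Qbar"
  "count_list (map letter_star w) Qbar = count_list w Q"
proof -
  have "count_list (map letter_star w) Q = count_list w Qbar \<and>
        count_list (map letter_star w) Qbar = count_list w Q"
  proof (induction w)
    case (Cons x w)
    then show ?case by (cases x) simp_all
  qed simp
  then show "count_list (map letter_star w) Q = count_list w Qbar"
    "count_list (map letter_star w) Qbar = count_list w Q" by auto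
qed

instantiation word :: star
begin
lift_definition star_word :: "word \<Rightarrow> word" is "\<lambda>w. map letter_star (rev w)"
  by (simp add: normal_form_eq_iff count_list_map_letter_star)
instance ..
end

lemma letter_star_letter_star [simp]: "letter_star (letter_star x) = x"
  by (cases x) auto

lemma word_star_simps:
  fixes u v :: word
  shows "(u\<^sup>\<star>)\<^sup>\<star> = u" "(u + v)\<^sup>\<star> = v\<^sup>\<star> + u\<^sup>\<star>" "(0 :: word)\<^sup>\<star> = 0"
    "word_Q\<^sup>\<star> = word_Qbar" "word_Qbar\<^sup>\<star> = word_Q"
  by (transfer; simp add: rev_map comp_def)+

lemma word_Q_Qbar_commute: "word_Q + word_Qbar = word_Qbar + word_Q"
  by transfer simp

lemma inj_word_star: "inj (star :: word \<Rightarrow> word)"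
  by (metis injI word_star_simps(1))

primrec letter_eval :: "quat \<Rightarrow> letter \<Rightarrow> quat" where
  "letter_eval a Q = a"
| "letter_eval a Qbar = a\<^sup>\<star>"

lemma prod_letter_eval_normal_form:
  "prod_list (map (letter_eval a) w) =
     of_real (quat_sqnorm a ^ fst (normal_form w)) *
     prod_list (map (letter_eval a) (snd (normal_form w)))"
proof (induction w)
  case (Cons x w)
  obtain k v where kv: "normal_form w = (k, v)" by fastforce
  have 1: "letter_eval a x * (of_real (quat_sqnorm a ^ k) * z) =
      of_real (quat_sqnorm a ^ k) * (letter_eval a x * z)" for z
    by (metis mult.assoc of_real_quat_commute)
  show ?case
  proof (cases v)
    case Nil
    then show ?thesis using Cons.IH kv 1[of 1] by simp
  next
    case (Cons y v')
    have 2: "letter_eval a x * (letter_eval a y * z) = of_real (quat_sqnorm a) * z" if "x \<noteq> y" for z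
      using that by (cases x; cases y) (simp_all add: quat_mult_star flip: mult.assoc)
    show ?thesis using Cons.IH kv 1 2 Cons
      by (simp add: mult.assoc) (metis mult.assoc power_commutes)
  qed
qed simp

lift_definition word_eval :: "quat \<Rightarrow> word \<Rightarrow> quat" is
  "\<lambda>a w. prod_list (map (letter_eval a) w)"
  by (subst (1 2) prod_letter_eval_normal_form) simp

lemma word_eval_simps:
  "word_eval a 0 = 1" "word_eval a (u + v) = word_eval a u * word_eval a v"
  "word_eval a word_Q = a" "word_eval a word_Qbar = a\<^sup>\<star>"
  by (transfer; simp)+

lemma word_eval_star: "word_eval a (w\<^sup>\<star>) = (word_eval a w)\<^sup>\<star>"
proof transfer
  fix a w
  show "prod_list (map (letter_eval a) (map letter_star (rev w))) =
    (prod_list (map (letter_eval a) w))\<^sup>\<star>"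
  proof (induction w)
    case (Cons x w)
    then show ?case by (cases x) (simp_all add: quat_star_simps)
  qed (simp add: quat_star_simps)
qed


section \<open>The algebra of real polynomials\<close>

type_synonym rpoly = "word \<Rightarrow>\<^sub>0 real"

definition rpoly_star :: "rpoly \<Rightarrow> rpoly" where
  "rpoly_star p = Poly_Mapping.map_key star p"

definition rpoly_eval :: "quat \<Rightarrow> rpoly \<Rightarrow> quat" where
  "rpoly_eval a p = (\<Sum>w\<in>Poly_Mapping.keys p. Poly_Mapping.lookup p w *\<^sub>R word_eval a w)"

lemma rpoly_induct [case_names zero add]:
  assumes "P 0" and "\<And>w r p. P p \<Longrightarrow> P (Poly_Mapping.single w r + p)"
  shows "P (p :: 'a \<Rightarrow>\<^sub>0 real)"
proof (induction p rule: update_induct)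
  case const
  then show ?case using assms(1) by simp
next
  case (update f a b)
  have "Poly_Mapping.update a b f = Poly_Mapping.single a b + f"
    using update(1)
    by (intro poly_mapping_eqI)
       (auto simp: lookup_update lookup_add lookup_single when_def in_keys_iff)
  then show ?case using assms(2) update by simp
qed

lemma rpoly_star_simps:
  "rpoly_star (Poly_Mapping.single w r) = Poly_Mapping.single (w\<^sup>\<star>) r"
  "rpoly_star 0 = 0" "rpoly_star (p + p') = rpoly_star p + rpoly_star p'"
proof -
  show "rpoly_star (Poly_Mapping.single w r) = Poly_Mapping.single (w\<^sup>\<star>) r"
    using map_key_single[OF inj_word_star, of "w\<^sup>\<star>" r]
    by (simp add: rpoly_star_def word_star_simps)
  show "rpoly_star (p + p') = rpoly_star p + rpoly_star p'"
    by (simp add: rpoly_star_def map_key_plus inj_word_star)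
  show "rpoly_star 0 = 0"
    by (simp add: rpoly_star_def inj_word_star)
qed

lemma rpoly_star_mult: "rpoly_star (p * p') = rpoly_star p' * rpoly_star p"
proof (induction p rule: rpoly_induct)
  case (add w r p)
  have "rpoly_star (Poly_Mapping.single w r * p') = rpoly_star p' * rpoly_star (Poly_Mapping.single w r)"
    by (induction p' rule: rpoly_induct)
       (simp_all add: rpoly_star_simps mult_single word_star_simps algebra_simps)
  then show ?case using add by (simp add: rpoly_star_simps algebra_simps)
qed (simp add: rpoly_star_simps)

lemma rpoly_star_star: "rpoly_star (rpoly_star p) = p"
  by (induction p rule: rpoly_induct) (simp_all add: rpoly_star_simps word_star_simps)

lemma rpoly_eval_superset:
  assumes "finite S" "Poly_Mapping.keys p \<subseteq> S"
  shows "rpoly_eval a p = (\<Sum>w\<in>S. Poly_Mapping.lookup p w *\<^sub>R word_eval a w)"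
  unfolding rpoly_eval_def
  by (rule sum.mono_neutral_left) (use assms in \<open>auto simp: in_keys_iff\<close>)

lemma rpoly_eval_add: "rpoly_eval a (p + p') = rpoly_eval a p + rpoly_eval a p'"
proof -
  let ?S = "Poly_Mapping.keys p \<union> Poly_Mapping.keys p'"
  have "Poly_Mapping.keys (p + p') \<subseteq> ?S" by (rule keys_add)
  then show ?thesis
    by (simp add: rpoly_eval_superset[where S = ?S] lookup_add scaleR_add_left sum.distrib)
qed

lemma rpoly_eval_single: "rpoly_eval a (Poly_Mapping.single w r) = r *\<^sub>R word_eval a w"
  by (simp add: rpoly_eval_def)

lemma rpoly_eval_zero: "rpoly_eval a 0 = 0"
  by (simp add: rpoly_eval_def)

lemma rpoly_eval_mult: "rpoly_eval a (p * p') = rpoly_eval a p * rpoly_eval a p'"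
proof (induction p rule: rpoly_induct)
  case (add w r p)
  have "rpoly_eval a (Poly_Mapping.single w r * p') =
      rpoly_eval a (Poly_Mapping.single w r) * rpoly_eval a p'"
    by (induction p' rule: rpoly_induct)
       (simp_all add: rpoly_eval_single rpoly_eval_add rpoly_eval_zero mult_single
          word_eval_simps algebra_simps)
  then show ?case using add by (simp add: rpoly_eval_add algebra_simps)
qed (simp add: rpoly_eval_zero)

lemma rpoly_eval_star: "rpoly_eval a (rpoly_star p) = (rpoly_eval a p)\<^sup>\<star>"
  by (induction p rule: rpoly_induct)
     (simp_all add: rpoly_star_simps rpoly_eval_zero rpoly_eval_add rpoly_eval_single
        quat_star_simps word_eval_star)


section \<open>The real free product of the quaternions and the real polynomials\<close>

text \<open>The free product (coproduct of unital real algebras), as formal expressions in elements of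
  the two factors modulo the least ring congruence under which both inclusions are ring
  homomorphisms, the two copies of the reals coincide, and the reals are central.\<close>

datatype hexpr =
    Con quat
  | Pol rpoly
  | Plus hexpr hexpr
  | Times hexpr hexpr

inductive hexpr_eq :: "hexpr \<Rightarrow> hexpr \<Rightarrow> bool" (infix \<open>\<doteq>\<close> 50) where
  hexpr_refl: "x \<doteq> x"
| hexpr_sym: "x \<doteq> y \<Longrightarrow> y \<doteq> x"
| hexpr_trans: "x \<doteq> y \<Longrightarrow> y \<doteq> z \<Longrightarrow> x \<doteq> z"
| hexpr_Plus_cong: "x \<doteq> x' \<Longrightarrow> y \<doteq> y' \<Longrightarrow> Plus x y \<doteq> Plus x' y'"
| hexpr_Times_cong: "x \<doteq> x' \<Longrightarrow> y \<doteq> y' \<Longrightarrow> Times x y \<doteq> Times x' y'"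
| hexpr_Plus_assoc: "Plus (Plus x y) z \<doteq> Plus x (Plus y z)"
| hexpr_Plus_comm: "Plus x y \<doteq> Plus y x"
| hexpr_Plus_zero: "Plus (Con 0) x \<doteq> x"
| hexpr_Plus_neg: "Plus (Times (Con (- 1)) x) x \<doteq> Con 0"
| hexpr_Times_assoc: "Times (Times x y) z \<doteq> Times x (Times y z)"
| hexpr_one_left: "Times (Con 1) x \<doteq> x"
| hexpr_one_right: "Times x (Con 1) \<doteq> x"
| hexpr_distrib_right: "Times (Plus x y) z \<doteq> Plus (Times x z) (Times y z)"
| hexpr_distrib_left: "Times x (Plus y z) \<doteq> Plus (Times x y) (Times x z)"
| hexpr_Con_add: "Con (a + b) \<doteq> Plus (Con a) (Con b)"
| hexpr_Con_mult: "Con (a * b) \<doteq> Times (Con a) (Con b)"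
| hexpr_Pol_add: "Pol (p + p') \<doteq> Plus (Pol p) (Pol p')"
| hexpr_Pol_mult: "Pol (p * p') \<doteq> Times (Pol p) (Pol p')"
| hexpr_real_eq: "Con (of_real r) \<doteq> Pol (Poly_Mapping.single 0 r)"
| hexpr_real_central: "Times (Con (of_real r)) x \<doteq> Times x (Con (of_real r))"

quotient_type hpoly = hexpr / hexpr_eq
  by (auto intro!: equivpI reflpI sympI transpI intro: hexpr_refl hexpr_sym hexpr_trans)

primrec hexpr_eval :: "quat \<Rightarrow> hexpr \<Rightarrow> quat" where
  "hexpr_eval a (Con c) = c"
| "hexpr_eval a (Pol p) = rpoly_eval a p"
| "hexpr_eval a (Plus x y) = hexpr_eval a x + hexpr_eval a y"
| "hexpr_eval a (Times x y) = hexpr_eval a x * hexpr_eval a y"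

text \<open>Evaluation \<open>q \<mapsto> a\<close>, \<open>qbar \<mapsto> a\<^sup>\<star>\<close>.\<close>

lift_definition heval :: "quat \<Rightarrow> hpoly \<Rightarrow> quat" is hexpr_eval
proof -
  fix a x y
  assume "x \<doteq> y"
  then show "hexpr_eval a x = hexpr_eval a y"
    by induction
       (simp_all add: algebra_simps rpoly_eval_add rpoly_eval_mult rpoly_eval_single
          word_eval_simps of_real_quat_commute, simp_all add: of_real_def)
qed

lift_definition hcon :: "quat \<Rightarrow> hpoly" is Con .
lift_definition hpol :: "rpoly \<Rightarrow> hpoly" is Pol .

instantiation hpoly :: "{ring_1, real_algebra_1}"
begin
lift_definition zero_hpoly :: hpoly is "Con 0" .
lift_definition one_hpoly :: hpoly is "Con 1" .
lift_definition plus_hpoly :: "hpoly \<Rightarrow> hpoly \<Rightarrow> hpoly" is Plus by (rule hexpr_Plus_cong)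
lift_definition times_hpoly :: "hpoly \<Rightarrow> hpoly \<Rightarrow> hpoly" is Times by (rule hexpr_Times_cong)
definition uminus_hpoly :: "hpoly \<Rightarrow> hpoly" where "- x = hcon (- 1) * x"
definition minus_hpoly :: "hpoly \<Rightarrow> hpoly \<Rightarrow> hpoly" where "x - y = x + - y" for x y :: hpoly
definition scaleR_hpoly :: "real \<Rightarrow> hpoly \<Rightarrow> hpoly" where "r *\<^sub>R x = hcon (of_real r) * x"
instance
proof
  fix x y z :: hpoly and r s :: real
  show "x + y + z = x + (y + z)" by transfer (rule hexpr_Plus_assoc)
  show "x + y = y + x" by transfer (rule hexpr_Plus_comm)
  show "0 + x = x" by transfer (rule hexpr_Plus_zero)
  show "- x + x = 0" unfolding uminus_hpoly_def by transfer (rule hexpr_Plus_neg)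
  show "x - y = x + - y" by (rule minus_hpoly_def)
  show times_assoc: "x * y * z = x * (y * z)" for x y z :: hpoly by transfer (rule hexpr_Times_assoc)
  show one: "1 * x = x" "x * 1 = x" for x :: hpoly
    by (transfer; rule hexpr_one_left hexpr_one_right)+
  show dr: "(x + y) * z = x * z + y * z" for x y z :: hpoly by transfer (rule hexpr_distrib_right)
  show dl: "x * (y + z) = x * y + x * z" for x y z :: hpoly by transfer (rule hexpr_distrib_left)
  have "heval 0 0 \<noteq> heval 0 1" by transfer simp
  then show "(0 :: hpoly) \<noteq> 1" by metis
  have con_add: "hcon (a + b) = hcon a + hcon b" for a b by transfer (rule hexpr_Con_add)
  have con_mult: "hcon (a * b) = hcon a * hcon b" for a b by transfer (rule hexpr_Con_mult)
  have central: "hcon (of_real r) * x = x * hcon (of_real r)" for r x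
    by transfer (rule hexpr_real_central)
  show "r *\<^sub>R (x + y) = r *\<^sub>R x + r *\<^sub>R y" by (simp add: scaleR_hpoly_def dl)
  show "(r + s) *\<^sub>R x = r *\<^sub>R x + s *\<^sub>R x" by (simp add: scaleR_hpoly_def con_add dr)
  show "r *\<^sub>R s *\<^sub>R x = (r * s) *\<^sub>R x" by (simp add: scaleR_hpoly_def con_mult times_assoc)
  have "hcon 1 = 1" by transfer (rule hexpr_refl)
  then show "1 *\<^sub>R x = x" by (simp add: scaleR_hpoly_def one)
  show "r *\<^sub>R x * y = r *\<^sub>R (x * y)" by (simp add: scaleR_hpoly_def times_assoc)
  show "x * r *\<^sub>R y = r *\<^sub>R (x * y)"
    unfolding scaleR_hpoly_def by (metis central times_assoc)
qed
end

lemma hcon_simps: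
  "hcon (a + b) = hcon a + hcon b" "hcon (a * b) = hcon a * hcon b"
  "hcon 0 = 0" "hcon 1 = 1" "hcon (of_real r) = of_real r"
proof -
  show "hcon (a + b) = hcon a + hcon b" by transfer (rule hexpr_Con_add)
  show "hcon (a * b) = hcon a * hcon b" by transfer (rule hexpr_Con_mult)
  show "hcon 0 = 0" by transfer (rule hexpr_refl)
  show "hcon 1 = 1" by transfer (rule hexpr_refl)
  show "hcon (of_real r) = of_real r" by (simp add: of_real_def[where 'a=hpoly] scaleR_hpoly_def)
qed

lemma hpol_simps:
  "hpol (p + p') = hpol p + hpol p'" "hpol (p * p') = hpol p * hpol p'"
  "hpol (Poly_Mapping.single 0 r) = of_real r"
proof -
  show "hpol (p + p') = hpol p + hpol p'" by transfer (rule hexpr_Pol_add)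
  show "hpol (p * p') = hpol p * hpol p'" by transfer (rule hexpr_Pol_mult)
  have "hpol (Poly_Mapping.single 0 r) = hcon (of_real r)"
    by transfer (rule hexpr_sym[OF hexpr_real_eq])
  then show "hpol (Poly_Mapping.single 0 r) = of_real r" by (simp add: hcon_simps)
qed

primrec hexpr_star :: "hexpr \<Rightarrow> hexpr" where
  "hexpr_star (Con c) = Con (c\<^sup>\<star>)"
| "hexpr_star (Pol p) = Pol (rpoly_star p)"
| "hexpr_star (Plus x y) = Plus (hexpr_star x) (hexpr_star y)"
| "hexpr_star (Times x y) = Times (hexpr_star y) (hexpr_star x)"

instantiation hpoly :: star
begin
lift_definition star_hpoly :: "hpoly \<Rightarrow> hpoly" is hexpr_star
proof -
  fix x y
  assume "x \<doteq> y"
  then show "hexpr_star x \<doteq> hexpr_star y"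
  proof induction
    case (hexpr_Plus_neg x)
    let ?x = "hexpr_star x"
    have "(- 1 :: quat)\<^sup>\<star> = - 1" by (simp add: star_quat_def quat_defs)
    moreover have "Times ?x (Con (- 1)) \<doteq> Times (Con (- 1)) ?x"
      using hexpr_sym[OF hexpr_real_central[of "- 1" ?x]] by simp
    then have "Plus (Times ?x (Con (- 1))) ?x \<doteq> Plus (Times (Con (- 1)) ?x) ?x"
      by (rule hexpr_Plus_cong[OF _ hexpr_refl])
    then have "Plus (Times ?x (Con (- 1))) ?x \<doteq> Con 0"
      by (rule hexpr_trans) (rule hexpr_eq.hexpr_Plus_neg)
    ultimately show ?case by (simp add: quat_star_simps)
  next
    case (hexpr_sym x y)
    show ?case by (rule hexpr_eq.hexpr_sym) fact
  next
    case (hexpr_trans x y z)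
    show ?case by (rule hexpr_eq.hexpr_trans) fact+
  next
    case (hexpr_real_central r x)
    show ?case by (simp add: quat_star_simps hexpr_eq.hexpr_sym[OF hexpr_eq.hexpr_real_central])
  next
    case (hexpr_Times_assoc x y z)
    show ?case by (simp add: hexpr_eq.hexpr_sym[OF hexpr_eq.hexpr_Times_assoc])
  qed (simp_all add: quat_star_simps rpoly_star_simps rpoly_star_mult word_star_simps
      hexpr_refl hexpr_Plus_cong hexpr_Times_cong hexpr_Plus_assoc hexpr_Plus_comm
      hexpr_Plus_zero hexpr_one_left hexpr_one_right hexpr_distrib_left hexpr_distrib_right
      hexpr_Con_add hexpr_Con_mult hexpr_Pol_add hexpr_Pol_mult hexpr_real_eq)
qed
instance ..
end

lemma hpoly_star_simps:
  fixes x y :: hpoly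
  shows "(x + y)\<^sup>\<star> = x\<^sup>\<star> + y\<^sup>\<star>" "(x * y)\<^sup>\<star> = y\<^sup>\<star> * x\<^sup>\<star>"
    "(hcon c)\<^sup>\<star> = hcon (c\<^sup>\<star>)" "(hpol p)\<^sup>\<star> = hpol (rpoly_star p)"
  by (transfer; simp add: hexpr_refl)+

lemma hpoly_star_star: "(x\<^sup>\<star>)\<^sup>\<star> = (x :: hpoly)"
proof transfer
  fix x show "hexpr_star (hexpr_star x) \<doteq> x"
    by (induction x)
       (auto simp: quat_star_simps rpoly_star_star intro: hexpr_refl hexpr_Plus_cong hexpr_Times_cong)
qed

lemma heval_simps:
  "heval a (x + y) = heval a x + heval a y" "heval a (x * y) = heval a x * heval a y"
  "heval a (hcon c) = c" "heval a (hpol p) = rpoly_eval a p"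
  "heval a 0 = 0" "heval a 1 = 1"
  by (transfer; simp)+

lemma heval_more_simps:
  "heval a (- x) = - heval a x" "heval a (x - y) = heval a x - heval a y"
  "heval a (r *\<^sub>R x) = r *\<^sub>R heval a x" "heval a (of_real r) = of_real r"
proof -
  show 1: "heval a (- x) = - heval a x" for x by (simp add: uminus_hpoly_def heval_simps)
  show "heval a (x - y) = heval a x - heval a y"
    using heval_simps(1)[of a x "- y"] by (simp add: 1)
  show 2: "heval a (r *\<^sub>R x) = r *\<^sub>R heval a x" for x
    by (simp add: scaleR_hpoly_def heval_simps) (simp add: of_real_def)
  show "heval a (of_real r) = of_real r"
    unfolding of_real_def by (simp add: heval_simps 2)
qed

lemma heval_star: "heval a (x\<^sup>\<star>) = (heval a x)\<^sup>\<star>"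
proof transfer
  fix a x show "hexpr_eval a (hexpr_star x) = (hexpr_eval a x)\<^sup>\<star>"
    by (induction x) (simp_all add: quat_star_simps rpoly_eval_star)
qed


section \<open>Polynomials and quadratic modules\<close>

definition hword :: "word \<Rightarrow> hpoly" where
  "hword w = hpol (Poly_Mapping.single w 1)"

definition hq :: hpoly where "hq = hword word_Q"
definition hqbar :: hpoly where "hqbar = hword word_Qbar"

text \<open>\<open>|q|\<^sup>2\<close> commutes with the letters, but not with the quaternionic constants.\<close>

definition sqnorm_q :: hpoly where
  "sqnorm_q = hword (word_Q + word_Qbar)"

definition coord0 :: hpoly where "coord0 = (1/2) *\<^sub>R (hq + hqbar)"
definition coord1 :: hpoly where "coord1 = (1/2) *\<^sub>R (hcon quat_i * hqbar - hq * hcon quat_i)"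
definition coord2 :: hpoly where "coord2 = (1/2) *\<^sub>R (hcon quat_j * hqbar - hq * hcon quat_j)"
definition coord3 :: hpoly where "coord3 = (1/2) *\<^sub>R (hcon quat_k * hqbar - hq * hcon quat_k)"

definition left_polys :: "hpoly set" where
  "left_polys = {\<Sum>w\<in>S. hcon (c w) * hword w | S c. finite S}"

definition bi_polys :: "hpoly set" where
  "bi_polys = {\<Sum>(u, v)\<in>S. hword u * hcon (c u v) * hword v | S c. finite S}"

definition vanishing_ideal :: "hpoly set" where
  "vanishing_ideal = {p. \<forall>a. heval a p = 0}"

definition SOS :: "hpoly set" where
  "SOS = {\<Sum>s<m. (p s)\<^sup>\<star> * p s | (m :: nat) p. \<forall>s<m. p s \<in> left_polys}"

definition quad_module :: "hpoly list \<Rightarrow> hpoly \<Rightarrow> hpoly set" where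
  "quad_module gs h =
     {\<sigma>0 + (1/2) *\<^sub>R (\<Sum>i<length gs. \<sigma> i * gs ! i + gs ! i * \<sigma> i)
         + (\<Sum>\<alpha><m. \<tau> \<alpha> * h * (\<nu> \<alpha>)\<^sup>\<star> + \<nu> \<alpha> * h\<^sup>\<star> * (\<tau> \<alpha>)\<^sup>\<star>)
      | \<sigma>0 \<sigma> (m :: nat) \<tau> \<nu>.
          \<sigma>0 \<in> SOS \<and> (\<forall>i<length gs. \<sigma> i \<in> SOS) \<and>
          (\<forall>\<alpha><m. \<tau> \<alpha> \<in> left_polys \<and> \<nu> \<alpha> \<in> left_polys)}"

definition hermitian :: "quat^'n^'n \<Rightarrow> bool" where
  "hermitian M \<longleftrightarrow> (\<forall>i j. (M $ i $ j)\<^sup>\<star> = M $ j $ i)"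

definition hform :: "quat^'n^'n \<Rightarrow> hpoly^'n \<Rightarrow> hpoly" where
  "hform M v = (\<Sum>i\<in>UNIV. \<Sum>j\<in>UNIV. (v $ i)\<^sup>\<star> * hcon (M $ i $ j) * v $ j)"


section \<open>Basic facts\<close>

lemma hword_simps:
  "hword 0 = 1" "hword (u + v) = hword u * hword v" "(hword w)\<^sup>\<star> = hword (w\<^sup>\<star>)"
  "heval a (hword w) = word_eval a w"
proof -
  show "hword 0 = 1" using hpol_simps(3)[of 1] by (simp add: hword_def)
  show "hword (u + v) = hword u * hword v"
    by (simp add: hword_def mult_single flip: hpol_simps(2))
  show "(hword w)\<^sup>\<star> = hword (w\<^sup>\<star>)"
    by (simp add: hword_def hpoly_star_simps rpoly_star_simps)
  show "heval a (hword w) = word_eval a w"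
    by (simp add: hword_def heval_simps rpoly_eval_single)
qed

lemma sqnorm_q_eq: "sqnorm_q = hq * hqbar" "sqnorm_q = hqbar * hq"
  by (simp_all add: sqnorm_q_def hq_def hqbar_def flip: hword_simps(2) word_Q_Qbar_commute)

lemma hq_simps: "hq\<^sup>\<star> = hqbar" "hqbar\<^sup>\<star> = hq" "heval a hq = a" "heval a hqbar = a\<^sup>\<star>"
  by (simp_all add: hq_def hqbar_def hword_simps word_star_simps word_eval_simps)

lemma heval_coord:
  "heval a coord0 = of_real (qRe a)" "heval a coord1 = of_real (qI a)"
  "heval a coord2 = of_real (qJ a)" "heval a coord3 = of_real (qK a)"
  by (simp_all add: coord0_def coord1_def coord2_def coord3_def heval_simps heval_more_simps
      hq_simps quat_i_def quat_j_def quat_k_def star_quat_def of_real_quat quat_defs)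

lemma heval_sqnorm_q: "heval a sqnorm_q = of_real (quat_sqnorm a)"
  by (simp add: sqnorm_q_eq heval_simps hq_simps quat_mult_star)

lemma hpoly_star_more_simps:
  fixes x y :: hpoly
  shows "(- x)\<^sup>\<star> = - x\<^sup>\<star>" "(x - y)\<^sup>\<star> = x\<^sup>\<star> - y\<^sup>\<star>" "(r *\<^sub>R x)\<^sup>\<star> = r *\<^sub>R x\<^sup>\<star>"
    "(of_real r :: hpoly)\<^sup>\<star> = of_real r" "(1 :: hpoly)\<^sup>\<star> = 1" "(0 :: hpoly)\<^sup>\<star> = 0"
proof -
  show c: "(of_real r :: hpoly)\<^sup>\<star> = of_real r" for r
    using hpoly_star_simps(3)[of "of_real r"] by (simp add: hcon_simps quat_star_simps)
  show s: "(r *\<^sub>R x)\<^sup>\<star> = r *\<^sub>R x\<^sup>\<star>" for r and x :: hpoly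
    by (simp add: scaleR_conv_of_real hpoly_star_simps c) (simp add: of_real_def)
  show m: "(- x)\<^sup>\<star> = - x\<^sup>\<star>" for x :: hpoly
    using s[of "- 1" x] by simp
  show "(x - y)\<^sup>\<star> = x\<^sup>\<star> - y\<^sup>\<star>"
    using hpoly_star_simps(1)[of x "- y"] by (simp add: m)
  show "(1 :: hpoly)\<^sup>\<star> = 1" "(0 :: hpoly)\<^sup>\<star> = 0"
    using c[of 1] c[of 0] by simp_all
qed

lemma coord_in_Sym: "coord0 \<in> Sym" "coord1 \<in> Sym" "coord2 \<in> Sym" "coord3 \<in> Sym"
proof -
  have [simp]: "quat_i\<^sup>\<star> = - quat_i" "quat_j\<^sup>\<star> = - quat_j" "quat_k\<^sup>\<star> = - quat_k"
    by (simp_all add: quat_i_def quat_j_def quat_k_def star_quat_def quat_defs)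
  have [simp]: "hcon (- c) = - hcon c" for c
    using hcon_simps(2)[of "- 1" c] by (simp add: uminus_hpoly_def)
  show "coord0 \<in> Sym" "coord1 \<in> Sym" "coord2 \<in> Sym" "coord3 \<in> Sym"
    by (simp_all add: Sym_def coord0_def coord1_def coord2_def coord3_def hpoly_star_simps
        hpoly_star_more_simps hq_simps add.commute)
qed

lemma vanishing_ideal_closed:
  "p \<in> vanishing_ideal \<Longrightarrow> p' \<in> vanishing_ideal \<Longrightarrow> p + p' \<in> vanishing_ideal"
  "p \<in> vanishing_ideal \<Longrightarrow> x * p * y \<in> vanishing_ideal"
  "p \<in> vanishing_ideal \<Longrightarrow> p\<^sup>\<star> \<in> vanishing_ideal"
  by (simp_all add: vanishing_ideal_def heval_simps heval_star quat_star_simps)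

lemma bi_polys_monomial: "hword u * hcon c * hword v \<in> bi_polys"
  unfolding bi_polys_def by (auto intro!: exI[of _ "{(u, v)}"] exI[of _ "\<lambda>_ _. c"])

lemma bi_polys_add:
  assumes "p \<in> bi_polys" "p' \<in> bi_polys"
  shows "p + p' \<in> bi_polys"
proof -
  let ?m = "\<lambda>c (u, v). hword u * hcon (c u v) * hword v"
  obtain S c S' c' where S: "finite S" "p = (\<Sum>x\<in>S. ?m c x)" "finite S'" "p' = (\<Sum>x\<in>S'. ?m c' x)"
    using assms unfolding bi_polys_def by blast
  define d where "d = (\<lambda>u v. if (u, v) \<in> S then c u v else 0)"
  define d' where "d' = (\<lambda>u v. if (u, v) \<in> S' then c' u v else 0)"
  have "p = (\<Sum>x\<in>S \<union> S'. ?m d x)" "p' = (\<Sum>x\<in>S \<union> S'. ?m d' x)"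
    unfolding S(2,4)
    by (rule sum.mono_neutral_cong_left; use S(1,3) in \<open>auto simp: d_def d'_def hcon_simps\<close>)+
  then have "p + p' = (\<Sum>x\<in>S \<union> S'. ?m (\<lambda>u v. d u v + d' u v) x)"
    by (simp add: hcon_simps distrib_left distrib_right case_prod_beta sum.distrib)
  then show ?thesis
    unfolding bi_polys_def using S(1,3)
    by (auto intro!: exI[of _ "S \<union> S'"] exI[of _ "\<lambda>u v. d u v + d' u v"])
qed

lemma coord_in_bi_polys:
  "coord0 \<in> bi_polys" "coord1 \<in> bi_polys" "coord2 \<in> bi_polys" "coord3 \<in> bi_polys"
proof -
  have *: "hcon c * hqbar + hq * hcon d \<in> bi_polys" for c d
    using bi_polys_add[OF bi_polys_monomial[of 0 c word_Qbar] bi_polys_monomial[of word_Q d 0]]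
    by (simp add: hword_simps hq_def hqbar_def)
  have neg: "hcon (- c) = - hcon c" for c
    using hcon_simps(2)[of "- 1" c] by (simp add: uminus_hpoly_def)
  have sc: "hcon (r *\<^sub>R c) = r *\<^sub>R hcon c" for r c
    by (simp add: scaleR_conv_of_real hcon_simps)
  show "coord0 \<in> bi_polys"
    using *[of "(1/2) *\<^sub>R 1" "(1/2) *\<^sub>R 1"]
    by (simp add: coord0_def sc hcon_simps(4) scaleR_add_right add.commute)
  show "coord1 \<in> bi_polys"
    using *[of "(1/2) *\<^sub>R quat_i" "- ((1/2) *\<^sub>R quat_i)"]
    by (simp add: coord1_def sc neg scaleR_diff_right)
  show "coord2 \<in> bi_polys"
    using *[of "(1/2) *\<^sub>R quat_j" "- ((1/2) *\<^sub>R quat_j)"]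
    by (simp add: coord2_def sc neg scaleR_diff_right)
  show "coord3 \<in> bi_polys"
    using *[of "(1/2) *\<^sub>R quat_k" "- ((1/2) *\<^sub>R quat_k)"]
    by (simp add: coord3_def sc neg scaleR_diff_right)
qed

end

theory Submission
  imports Defs
begin

text \<open>At a quaternion \<open>a\<close> with \<open>a\<^sup>2 = -1\<close> every word takes a value \<open>\<plusminus>1\<close> or
  \<open>\<plusminus>a\<close>, so a left polynomial evaluates to \<open>A + B a\<close> and a hermitian square to
  \<open>|A + B a|\<^sup>2\<close>, which is an affine function of \<open>a\<close> on the sphere of imaginary units.
  Such affine functions \<open>L \<ge> 0\<close> are too weak to localise at \<open>g\<^sub>3, g\<^sub>4, g\<^sub>5\<close>: the positive
  functional \<open>E F = \<Sum> F e + 4 F (-e)\<close>, with \<open>e\<close> ranging over \<open>i, j, k\<close>, satisfies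
  \<open>E (L g\<^sub>i) \<ge> 0\<close> for all \<open>i\<close> although \<open>E\<close> charges points outside of \<open>K\<close>, and \<open>E f = -3\<close>.\<close>

definition imag_unit :: "quat \<Rightarrow> bool" where
  "imag_unit a \<longleftrightarrow> qRe a = 0 \<and> quat_sqnorm a = 1"

section \<open>Components of quaternions and evaluation of sums\<close>

lemma quat_sel_simps [simp]:
  fixes x y :: quat
  shows "qRe (x + y) = qRe x + qRe y" "qI (x + y) = qI x + qI y"
    "qJ (x + y) = qJ x + qJ y" "qK (x + y) = qK x + qK y"
    "qRe (x - y) = qRe x - qRe y" "qI (x - y) = qI x - qI y"
    "qJ (x - y) = qJ x - qJ y" "qK (x - y) = qK x - qK y"
    "qRe (- x) = - qRe x" "qI (- x) = - qI x" "qJ (- x) = - qJ x" "qK (- x) = - qK x"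
    "qRe (r *\<^sub>R x) = r * qRe x" "qI (r *\<^sub>R x) = r * qI x"
    "qJ (r *\<^sub>R x) = r * qJ x" "qK (r *\<^sub>R x) = r * qK x"
    "qRe (x\<^sup>\<star>) = qRe x" "qI (x\<^sup>\<star>) = - qI x" "qJ (x\<^sup>\<star>) = - qJ x" "qK (x\<^sup>\<star>) = - qK x"
    "qRe (of_real r) = r" "qI (of_real r) = 0" "qJ (of_real r) = 0" "qK (of_real r) = 0"
    "qRe 0 = 0" "qI 0 = 0" "qJ 0 = 0" "qK 0 = 0"
    "qRe 1 = 1" "qI 1 = 0" "qJ 1 = 0" "qK 1 = 0"
  by (simp_all add: plus_quat_def minus_quat_def uminus_quat_def scaleR_quat_def star_quat_def
      zero_quat_def one_quat_def of_real_quat)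

lemma quat_sel_mult:
  fixes x y :: quat
  shows "qRe (x * y) = qRe x * qRe y - qI x * qI y - qJ x * qJ y - qK x * qK y"
    "qI (x * y) = qRe x * qI y + qI x * qRe y + qJ x * qK y - qK x * qJ y"
    "qJ (x * y) = qRe x * qJ y - qI x * qK y + qJ x * qRe y + qK x * qI y"
    "qK (x * y) = qRe x * qK y + qI x * qJ y - qJ x * qI y + qK x * qRe y"
  by (simp_all add: times_quat_def)

lemma quat_sel_numeral [simp]:
  "qRe (numeral n) = numeral n" "qI (numeral n) = 0" "qJ (numeral n) = 0" "qK (numeral n) = 0"
  using quat_sel_simps(21-24)[of "numeral n"] by simp_all

lemma quat_sqnorm_nonneg: "0 \<le> quat_sqnorm x"
  by (simp add: quat_sqnorm_def)

lemma qRe_sum: "qRe (sum f S) = (\<Sum>x\<in>S. qRe (f x))"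
  by (induction S rule: infinite_finite_induct) auto

lemma heval_sum: "heval a (sum f S) = (\<Sum>x\<in>S. heval a (f x))"
  by (induction S rule: infinite_finite_induct) (auto simp: heval_simps)

section \<open>Polynomials evaluated at imaginary units\<close>

lemma imag_unit_square: "imag_unit a \<Longrightarrow> a * a = - 1"
  by (auto simp: imag_unit_def quat_sqnorm_def quat_eq_iff quat_sel_mult power2_eq_square)

lemma imag_unit_star: "imag_unit a \<Longrightarrow> a\<^sup>\<star> = - a"
  by (auto simp: imag_unit_def quat_eq_iff)

text \<open>The relations \<open>a * a = - 1\<close> and \<open>a\<^sup>\<star> = - a\<close> reduce
  a word in the same way for every imaginary unit, so \<open>r\<close> and \<open>s\<close> depend
  on \<open>w\<close> alone.\<close>

lemma word_eval_imag_unit: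
  "\<exists>r s. \<forall>a. imag_unit a \<longrightarrow> word_eval a w = of_real r + s *\<^sub>R a"
proof transfer
  fix w
  show "\<exists>r s. \<forall>a. imag_unit a \<longrightarrow> prod_list (map (letter_eval a) w) = of_real r + s *\<^sub>R a"
  proof (induction w)
    case Nil
    show ?case by (intro exI[of _ 1] exI[of _ 0]) simp
  next
    case (Cons x w)
    then obtain r s where IH:
      "\<And>a. imag_unit a \<Longrightarrow> prod_list (map (letter_eval a) w) = of_real r + s *\<^sub>R a"
      by blast
    \<comment> \<open>Multiplying by \<open>a\<close> on the left turns (r, s) into (-s, r); the
      letter \<open>Qbar\<close> gives the opposite signs.\<close>
    have *: "a * (of_real r + s *\<^sub>R a) = of_real (- s) + r *\<^sub>R a" if "imag_unit a" for a
      using imag_unit_square[OF that]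
      by (simp add: distrib_left of_real_def)
    show ?case
    proof (cases x)
      case Q
      then show ?thesis
        by (intro exI[of _ "- s"] exI[of _ r]) (simp add: IH *[simplified])
    next
      case Qbar
      then show ?thesis
        by (intro exI[of _ s] exI[of _ "- r"])
           (simp add: IH *[simplified] imag_unit_star mult_minus_left)
    qed
  qed
qed

text \<open>All quaternionic coefficients stand to the left and the \<open>r\<close>,
  \<open>s\<close> of each word are real, so the terms collect into one \<open>A\<close> and one
  \<open>B\<close> valid for all imaginary units at once.\<close>

lemma left_poly_eval_imag_unit:
  assumes "p \<in> left_polys"
  obtains A B where "\<And>a. imag_unit a \<Longrightarrow> heval a p = A + B * a"
proof -
  obtain S c where p: "p = (\<Sum>w\<in>S. hcon (c w) * hword w)"
    using assms by (auto simp: left_polys_def)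
  obtain r s where rs: "\<And>w a. imag_unit a \<Longrightarrow> word_eval a w = of_real (r w) + s w *\<^sub>R a"
    using word_eval_imag_unit by metis
  have "heval a p = (\<Sum>w\<in>S. c w * of_real (r w)) + (\<Sum>w\<in>S. s w *\<^sub>R c w) * a"
    if "imag_unit a" for a
    by (simp add: p heval_sum heval_simps hword_simps rs[OF that] distrib_left sum.distrib
        sum_distrib_right)
  then show ?thesis by (rule that)
qed

text \<open>Each square evaluates to \<open>quat_sqnorm\<close> of a value, hence to a nonnegative
  real at every quaternion. The explicit form of \<open>L\<close>, with \<open>m\<close>,
  \<open>A\<close>, \<open>B\<close> independent of the point, is claimed on imaginary units
  only.\<close>

lemma SOS_eval:
  assumes "\<sigma> \<in> SOS"
  obtains L where "\<And>a. heval a \<sigma> = of_real (L a)" "\<And>a. 0 \<le> L a"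
    "\<exists>(m :: nat) A B. \<forall>a. imag_unit a \<longrightarrow> L a = (\<Sum>s<m. quat_sqnorm (A s + B s * a))"
proof -
  obtain m :: nat and p where \<sigma>: "\<sigma> = (\<Sum>s<m. (p s)\<^sup>\<star> * p s)"
    and p: "\<And>s. s < m \<Longrightarrow> p s \<in> left_polys"
    using assms by (auto simp: SOS_def)
  have "\<forall>s. \<exists>A B. s < m \<longrightarrow> (\<forall>a. imag_unit a \<longrightarrow> heval a (p s) = A + B * a)"
    using left_poly_eval_imag_unit[OF p] by metis
  then obtain A B where "\<And>s a. s < m \<Longrightarrow> imag_unit a \<Longrightarrow> heval a (p s) = A s + B s * a"
    by metis
  then show ?thesis
    by (intro that[of "\<lambda>a. \<Sum>s<m. quat_sqnorm (heval a (p s))"]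
          exI[of _ m] exI[of _ A] exI[of _ B])
       (auto simp: \<sigma> heval_sum heval_simps heval_star quat_mult_star
          intro!: sum_nonneg quat_sqnorm_nonneg)
qed

section \<open>The separating functional\<close>

text \<open>With a weight t >= 0 in place of 4, the value at f is 3(7 - 3t)/5, negative for t > 7/3,
  while nonnegativity on the products of |A + B a|^2 with g3, g4, g5 holds when t^2 - 4t - 7 <= 0.
  The weight 4 meets both conditions.\<close>

definition octahedral_sum :: "(quat \<Rightarrow> real) \<Rightarrow> real" where
  "octahedral_sum F = F quat_i + F quat_j + F quat_k + 4 * (F (- quat_i) + F (- quat_j) + F (- quat_k))"

lemma octahedral_sum_cong:
  "(\<And>a. imag_unit a \<Longrightarrow> F a = G a) \<Longrightarrow> octahedral_sum F = octahedral_sum G"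
  by (simp add: octahedral_sum_def imag_unit_def quat_i_def quat_j_def quat_k_def quat_sqnorm_def)

lemma octahedral_sum_add:
  "octahedral_sum (\<lambda>a. F a + G a) = octahedral_sum F + octahedral_sum G"
  by (simp add: octahedral_sum_def)

lemma octahedral_sum_sum:
  "octahedral_sum (\<lambda>a. \<Sum>x\<in>S. F x a) = (\<Sum>x\<in>S. octahedral_sum (F x))"
  by (simp add: octahedral_sum_def sum.distrib sum_distrib_left)

lemma octahedral_sum_nonneg: "(\<And>a. imag_unit a \<Longrightarrow> 0 \<le> F a) \<Longrightarrow> 0 \<le> octahedral_sum F"
  by (simp add: octahedral_sum_def imag_unit_def quat_i_def quat_j_def quat_k_def quat_sqnorm_def)

text \<open>Writing \<open>L a = |A + B a|\<^sup>2 = \<alpha> + \<beta> \<cdot> a\<close> on imaginary units, the value for the first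
  coordinate is \<open>9/2 \<alpha> + 7/2 \<beta>\<^sub>1 - 3/2 \<beta>\<^sub>2 - 3/2 \<beta>\<^sub>3\<close>, which equals
  \<open>27/8 L v + L i + 1/8 L (-i)\<close> for the imaginary unit \<open>v = (7i - 4j - 4k)/9\<close>.\<close>

lemma octahedral_sum_quat_sqnorm:
  fixes A B :: quat
  defines "L \<equiv> \<lambda>a. quat_sqnorm (A + B * a)"
  shows "0 \<le> octahedral_sum (\<lambda>a. L a * (1/2 + qI a))"
    "0 \<le> octahedral_sum (\<lambda>a. L a * (1/2 + qJ a))"
    "0 \<le> octahedral_sum (\<lambda>a. L a * (1/2 + qK a))"
proof -
  have "octahedral_sum (\<lambda>a. L a * (1/2 + qI a)) =
      27/8 * L (Quat 0 (7/9) (-4/9) (-4/9)) + L quat_i + 1/8 * L (- quat_i)"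
    "octahedral_sum (\<lambda>a. L a * (1/2 + qJ a)) =
      27/8 * L (Quat 0 (-4/9) (7/9) (-4/9)) + L quat_j + 1/8 * L (- quat_j)"
    "octahedral_sum (\<lambda>a. L a * (1/2 + qK a)) =
      27/8 * L (Quat 0 (-4/9) (-4/9) (7/9)) + L quat_k + 1/8 * L (- quat_k)"
    by (simp_all add: octahedral_sum_def L_def quat_sqnorm_def quat_sel_mult
        quat_i_def quat_j_def quat_k_def power2_eq_square algebra_simps)
  then show "0 \<le> octahedral_sum (\<lambda>a. L a * (1/2 + qI a))"
    "0 \<le> octahedral_sum (\<lambda>a. L a * (1/2 + qJ a))"
    "0 \<le> octahedral_sum (\<lambda>a. L a * (1/2 + qK a))"
    by (simp_all add: L_def quat_sqnorm_nonneg)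
qed

text \<open>The two alternatives for \<open>G\<close> separate the easy constraints, nonnegative on
  all imaginary units, from those that change sign there. For the latter the sum of squares is split
  into single squares, to which \<open>octahedral_sum_quat_sqnorm\<close> applies.\<close>

lemma octahedral_sum_SOS:
  assumes \<sigma>: "\<sigma> \<in> SOS" and g: "\<And>a. imag_unit a \<Longrightarrow> heval a g = of_real (G a)"
    and G: "(\<forall>a. imag_unit a \<longrightarrow> 0 \<le> G a) \<or>
      G \<in> {\<lambda>a. 1/2 + qI a, \<lambda>a. 1/2 + qJ a, \<lambda>a. 1/2 + qK a}"
  shows "0 \<le> octahedral_sum (\<lambda>a. qRe (heval a (\<sigma> * g + g * \<sigma>)))"
proof -
  obtain L m A B where L: "\<And>a. heval a \<sigma> = of_real (L a)" "\<And>a. 0 \<le> L a"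
    and LAB: "\<And>a. imag_unit a \<Longrightarrow> L a = (\<Sum>s<(m::nat). quat_sqnorm (A s + B s * a))"
    using SOS_eval[OF \<sigma>] by metis
  \<comment> \<open>Both factors have real values on imaginary units, so the two products agree
    there.\<close>
  have eq: "octahedral_sum (\<lambda>a. qRe (heval a (\<sigma> * g + g * \<sigma>))) = octahedral_sum (\<lambda>a. 2 * (L a * G a))"
    by (rule octahedral_sum_cong) (simp add: heval_simps L g quat_sel_mult)
  also have "\<dots> = 2 * octahedral_sum (\<lambda>a. L a * G a)"
    by (simp add: octahedral_sum_def)
  also have "\<dots> \<ge> 0"
  proof (cases "\<forall>a. imag_unit a \<longrightarrow> 0 \<le> G a")
    case True
    then show ?thesis using L(2) by (simp add: octahedral_sum_nonneg)
  next
    case False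
    have "octahedral_sum (\<lambda>a. L a * G a) =
        octahedral_sum (\<lambda>a. \<Sum>s<m. quat_sqnorm (A s + B s * a) * G a)"
      by (rule octahedral_sum_cong) (simp add: LAB sum_distrib_right)
    also have "\<dots> \<ge> 0"
      using False G octahedral_sum_quat_sqnorm
      unfolding octahedral_sum_sum by (auto intro!: sum_nonneg)
    finally show ?thesis by simp
  qed
  finally show ?thesis .
qed

lemma octahedral_sum_quad_module:
  assumes u: "u \<in> quad_module gs h" and h: "\<And>a. imag_unit a \<Longrightarrow> heval a h = 0"
    and gs: "\<And>g. g \<in> set gs \<Longrightarrow> \<exists>G. (\<forall>a. imag_unit a \<longrightarrow> heval a g = of_real (G a)) \<and>
      ((\<forall>a. imag_unit a \<longrightarrow> 0 \<le> G a) \<or>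
       G \<in> {\<lambda>a. 1/2 + qI a, \<lambda>a. 1/2 + qJ a, \<lambda>a. 1/2 + qK a})"
  shows "0 \<le> octahedral_sum (\<lambda>a. qRe (heval a u))"
proof -
  obtain \<sigma>0 \<sigma> \<tau> \<nu> and m :: nat where u: "u = \<sigma>0
      + (1/2) *\<^sub>R (\<Sum>i<length gs. \<sigma> i * gs ! i + gs ! i * \<sigma> i)
      + (\<Sum>\<alpha><m. \<tau> \<alpha> * h * (\<nu> \<alpha>)\<^sup>\<star> + \<nu> \<alpha> * h\<^sup>\<star> * (\<tau> \<alpha>)\<^sup>\<star>)"
    and \<sigma>0: "\<sigma>0 \<in> SOS" and \<sigma>: "\<And>i. i < length gs \<Longrightarrow> \<sigma> i \<in> SOS"
    using u by (auto simp: quad_module_def)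
  have "octahedral_sum (\<lambda>a. qRe (heval a u)) = octahedral_sum (\<lambda>a. qRe (heval a \<sigma>0)
      + (\<Sum>i<length gs. (1/2) * qRe (heval a (\<sigma> i * gs ! i + gs ! i * \<sigma> i))))"
    \<comment> \<open>Evaluation respects products and the involution, so every term with
      \<open>h\<close> or \<open>h\<^sup>\<star>\<close> vanishes on imaginary units.\<close>
    by (rule octahedral_sum_cong)
       (simp add: u heval_simps heval_more_simps heval_sum heval_star h qRe_sum
         quat_star_simps sum_divide_distrib)
  also have "\<dots> = octahedral_sum (\<lambda>a. qRe (heval a \<sigma>0))
      + (\<Sum>i<length gs. (1/2) * octahedral_sum (\<lambda>a. qRe (heval a (\<sigma> i * gs ! i + gs ! i * \<sigma> i))))"
    unfolding octahedral_sum_add octahedral_sum_sum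
    by (simp add: octahedral_sum_def algebra_simps)
  also have "\<dots> \<ge> 0"
  proof (intro add_nonneg_nonneg sum_nonneg mult_nonneg_nonneg)
    obtain L where "\<And>a. heval a \<sigma>0 = of_real (L a)" "\<And>a. 0 \<le> L a"
      using SOS_eval[OF \<sigma>0] by metis
    then show "0 \<le> octahedral_sum (\<lambda>a. qRe (heval a \<sigma>0))"
      by (simp add: octahedral_sum_nonneg)
  next
    fix i assume "i \<in> {..<length gs}"
    then have i: "i < length gs" by simp
    obtain G where G: "(\<forall>a. imag_unit a \<longrightarrow> heval a (gs ! i) = of_real (G a)) \<and>
      ((\<forall>a. imag_unit a \<longrightarrow> 0 \<le> G a) \<or>
       G \<in> {\<lambda>a. 1/2 + qI a, \<lambda>a. 1/2 + qJ a, \<lambda>a. 1/2 + qK a})"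
      using gs[OF nth_mem[OF i]] ..
    show "0 \<le> octahedral_sum (\<lambda>a. qRe (heval a (\<sigma> i * gs ! i + gs ! i * \<sigma> i)))"
      by (rule octahedral_sum_SOS[OF \<sigma>[OF i] _ conjunct2[OF G]]) (simp add: G)
  qed simp
  finally show ?thesis .
qed

section \<open>The minimum of f on K\<close>

lemma sum_ge_of_sphere_cap:
  fixes w x y z :: real
  assumes "w\<^sup>2 + x\<^sup>2 + y\<^sup>2 + z\<^sup>2 = 1" "\<bar>w\<bar> \<le> 1/10" "x \<ge> -1/2" "y \<ge> -1/2" "z \<ge> -1/2"
  shows "x + y + z \<ge> -3/10"
proof (rule ccontr)
  \<comment> \<open>Moving the corner (-1/2, -1/2, -1/2) to the origin makes all coordinates
    nonnegative. On the sphere S^2 - S - 6/25 equals 1/100 - w^2 plus twice the pairwise products,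
    which is nonnegative, whereas S^2 - S - 6/25 < 0 for 0 <= S < 6/5.\<close>
  define X Y Z S where "X = x + 1/2" "Y = y + 1/2" "Z = z + 1/2" "S = X + Y + Z"
  note defs = this
  assume "\<not> ?thesis"
  then have S: "0 \<le> X" "0 \<le> Y" "0 \<le> Z" "0 \<le> S" "S < 6/5"
    using assms(3-5) by (simp_all add: defs)
  have "w\<^sup>2 \<le> 1/100"
    using power_mono[OF assms(2), of 2] by (simp add: power2_eq_square)
  then have "0 \<le> (1/100 - w\<^sup>2) + 2 * (X * Y + X * Z + Y * Z)"
    using S by (intro add_nonneg_nonneg mult_nonneg_nonneg) simp_all
  also have "\<dots> = (S - 6/5) * (S + 1/5)"
    using assms(1) unfolding defs by algebra
  finally have "0 \<le> (S - 6/5) * (S + 1/5)" .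
  moreover have "(S - 6/5) * (S + 1/5) < 0"
    using S by (intro mult_neg_pos) auto
  ultimately show False by simp
qed

section \<open>Hermitian forms modulo the vanishing ideal, and the theorem\<close>

text \<open>The form of the matrix with rows (r, c) and (c^*, s) is r + c q + qbar c^* + qbar s q;
  its two middle terms evaluate to conjugate quaternions with sum 2 Re(c a).\<close>

lemma hermitian_form_exists:
  assumes "\<And>a. heval a p = of_real (r + 2 * qRe (c * a) + s * quat_sqnorm a)"
  shows "\<exists>M :: quat^2^2. hermitian M \<and> p - hform M (vector [1, hq]) \<in> vanishing_ideal"
proof -
  define M :: "quat^2^2" where "M = vector [vector [of_real r, c], vector [c\<^sup>\<star>, of_real s]]"
  have "hermitian M"
    by (simp add: hermitian_def M_def forall_2 quat_star_simps)
  moreover have "heval a (hform M (vector [1, hq])) = heval a p" for a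
    unfolding assms
    by (simp add: hform_def M_def sum_2 heval_simps heval_star hq_simps hpoly_star_more_simps
        quat_eq_iff quat_sel_mult quat_sqnorm_def power2_eq_square algebra_simps)
  ultimately show ?thesis
    by (auto simp: vanishing_ideal_def heval_more_simps)
qed

theorem mainTheorem7:
  fixes f h g1 g2 g3 g4 g5 :: hpoly and K :: "quat set"
  assumes h: "h = 1 - sqnorm_q"
    and g1: "g1 = of_real (1/10) + coord0"
    and g2: "g2 = of_real (1/10) - coord0"
    and g3: "g3 = of_real (1/2) + coord1"
    and g4: "g4 = of_real (1/2) + coord2"
    and g5: "g5 = of_real (1/2) + coord3"
    and f: "f = coord1 + coord2 + coord3 + of_real (2/5)"
    and K: "K = {a. heval a h = 0 \<and> (\<forall>g\<in>{g1, g2, g3, g4, g5}. 0 \<le> heval a g)}"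
  shows "((\<exists>a\<in>K. heval a f = of_real (1/10)) \<and> (\<forall>a\<in>K. of_real (1/10) \<le> heval a f)
            \<and> (0 :: real) < 1/10)
    \<and> f \<notin> {u + v | u v. u \<in> quad_module [g1, g2, g3, g4, g5] h
                         \<and> v \<in> vanishing_ideal \<inter> (Sym \<inter> bi_polys)}
    \<and> (\<forall>p\<in>{f, h, g1, g2, g3, g4, g5}. \<exists>M :: quat^2^2.
          hermitian M \<and> p - hform M (vector [1, hq]) \<in> vanishing_ideal)"
proof (intro conjI)
  note ev = heval_simps heval_more_simps heval_coord heval_sqnorm_q
  have K_iff: "a \<in> K \<longleftrightarrow> quat_sqnorm a = 1 \<and> \<bar>qRe a\<bar> \<le> 1/10 \<and>
      qI a \<ge> -1/2 \<and> qJ a \<ge> -1/2 \<and> qK a \<ge> -1/2" for a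
    by (auto simp: K h g1 g2 g3 g4 g5 ev less_eq_quat_def quat_eq_iff)
  have f_eval: "heval a f = of_real (qI a + qJ a + qK a + 2/5)" for a
    by (simp add: f ev)
  show "\<exists>a\<in>K. heval a f = of_real (1/10)"
    \<comment> \<open>The equality case of \<open>sum_ge_of_sphere_cap\<close>: w = 1/10 and two
      coordinates equal to -1/2.\<close>
    by (rule bexI[of _ "Quat (1/10) (-1/2) (-1/2) (7/10)"])
       (simp_all add: K_iff f_eval quat_sqnorm_def power2_eq_square del: of_real_add)
  show "\<forall>a\<in>K. of_real (1/10) \<le> heval a f"
  proof
    fix a assume "a \<in> K"
    then have "qI a + qJ a + qK a \<ge> -3/10"
      by (intro sum_ge_of_sphere_cap[of "qRe a"]) (auto simp: K_iff quat_sqnorm_def)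
    then show "of_real (1/10) \<le> heval a f"
      by (simp add: f_eval less_eq_quat_def del: of_real_add)
  qed
  show "(0 :: real) < 1/10" by simp
  show "f \<notin> {u + v | u v. u \<in> quad_module [g1, g2, g3, g4, g5] h
      \<and> v \<in> vanishing_ideal \<inter> (Sym \<inter> bi_polys)}"
  proof
    assume "f \<in> {u + v | u v. u \<in> quad_module [g1, g2, g3, g4, g5] h
      \<and> v \<in> vanishing_ideal \<inter> (Sym \<inter> bi_polys)}"
    then obtain u v where fuv: "f = u + v" and u: "u \<in> quad_module [g1, g2, g3, g4, g5] h"
      and v: "v \<in> vanishing_ideal" by blast
    have eq: "heval a u = heval a f" for a
      using v by (simp add: fuv heval_simps vanishing_ideal_def)
    have g_eval: "heval a g1 = of_real (1/10)" "heval a g2 = of_real (1/10)" "heval a h = 0"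
      "heval a g3 = of_real (1/2 + qI a)" "heval a g4 = of_real (1/2 + qJ a)"
      "heval a g5 = of_real (1/2 + qK a)" if "imag_unit a" for a
      using that by (simp_all add: g1 g2 g3 g4 g5 h ev imag_unit_def)
    have "0 \<le> octahedral_sum (\<lambda>a. qRe (heval a u))"
    proof (rule octahedral_sum_quad_module[OF u g_eval(3)])
      fix g assume "g \<in> set [g1, g2, g3, g4, g5]"
      then consider "g = g1 \<or> g = g2" | "g = g3" | "g = g4" | "g = g5" by auto
      then show "\<exists>G. (\<forall>a. imag_unit a \<longrightarrow> heval a g = of_real (G a)) \<and>
        ((\<forall>a. imag_unit a \<longrightarrow> 0 \<le> G a) \<or>
         G \<in> {\<lambda>a. 1/2 + qI a, \<lambda>a. 1/2 + qJ a, \<lambda>a. 1/2 + qK a})"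
      proof cases
        \<comment> \<open>On imaginary units \<open>coord0\<close> evaluates to 0, so both
          constraints are constant.\<close>
        case 1
        then show ?thesis using g_eval(1,2) by (intro exI[of _ "\<lambda>_. 1/10"]) auto
      next
        case 2
        then show ?thesis using g_eval(4) by (intro exI[of _ "\<lambda>a. 1/2 + qI a"]) blast
      next
        case 3
        then show ?thesis using g_eval(5) by (intro exI[of _ "\<lambda>a. 1/2 + qJ a"]) blast
      next
        case 4
        then show ?thesis using g_eval(6) by (intro exI[of _ "\<lambda>a. 1/2 + qK a"]) blast
      qed
    qed
    \<comment> \<open>f is 7/5 at the units i, j, k and -3/5 at their negatives, giving 21/5 -
      36/5.\<close>
    moreover have "octahedral_sum (\<lambda>a. qRe (heval a u)) = - 3"
      by (simp add: eq f_eval octahedral_sum_def quat_i_def quat_j_def quat_k_def del: of_real_add)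
    ultimately show False by simp
  qed
  show "\<forall>p\<in>{f, h, g1, g2, g3, g4, g5}. \<exists>M :: quat^2^2.
      hermitian M \<and> p - hform M (vector [1, hq]) \<in> vanishing_ideal"
  proof -
    note hf = hermitian_form_exists
    note ev' = ev quat_eq_iff quat_sel_mult
    have "\<exists>M :: quat^2^2. hermitian M \<and> f - hform M (vector [1, hq]) \<in> vanishing_ideal"
      \<comment> \<open>The sign of \<open>c\<close> comes from i^2 = -1: for c = -i/2, 2 Re(c a) is
        the i-coordinate of a.\<close>
      by (rule hf[of _ "2/5" "Quat 0 (-1/2) (-1/2) (-1/2)" 0]) (simp add: f ev')
    moreover have "\<exists>M :: quat^2^2. hermitian M \<and> h - hform M (vector [1, hq]) \<in> vanishing_ideal"
      by (rule hf[of _ 1 0 "-1"]) (simp add: h ev')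
    moreover have "\<exists>M :: quat^2^2. hermitian M \<and> g1 - hform M (vector [1, hq]) \<in> vanishing_ideal"
      by (rule hf[of _ "1/10" "Quat (1/2) 0 0 0" 0]) (simp add: g1 ev')
    moreover have "\<exists>M :: quat^2^2. hermitian M \<and> g2 - hform M (vector [1, hq]) \<in> vanishing_ideal"
      by (rule hf[of _ "1/10" "Quat (-1/2) 0 0 0" 0]) (simp add: g2 ev')
    moreover have "\<exists>M :: quat^2^2. hermitian M \<and> g3 - hform M (vector [1, hq]) \<in> vanishing_ideal"
      by (rule hf[of _ "1/2" "Quat 0 (-1/2) 0 0" 0]) (simp add: g3 ev')
    moreover have "\<exists>M :: quat^2^2. hermitian M \<and> g4 - hform M (vector [1, hq]) \<in> vanishing_ideal"
      by (rule hf[of _ "1/2" "Quat 0 0 (-1/2) 0" 0]) (simp add: g4 ev')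
    moreover have "\<exists>M :: quat^2^2. hermitian M \<and> g5 - hform M (vector [1, hq]) \<in> vanishing_ideal"
      by (rule hf[of _ "1/2" "Quat 0 0 0 (-1/2)" 0]) (simp add: g5 ev')
    ultimately show ?thesis by simp
  qed
qed

end
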